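(* Let $N\in\mathbb{N}$, $N\ge1$, let $\mathcal{G}_N$ be the set of all simple undirected graphs with vertex set $V=\{1,\ldots,N\}$, and let $\mathcal{B}^{\mathcal{G}_N}$ be the linear span of the constant function $1$ and the functions $\chi_{r,s}$, $1\le r<s\le N$, on $\mathcal{G}_N$. Let $n\ge1$ and $G_1,\ldots,G_n\in\mathcal{G}_N$. Then the maximum likelihood estimator (MLE) for $e(\mathcal{B}^{\mathcal{G}_N})$ and $G_1,\ldots,G_n$ exists if and only if $$\bigcup_{i=1}^nG_i=K_N\quad\text{and}\quad\bigcap_{i=1}^nG_i=\overline{K_N}.$$
   Context: For $1\le r<s\le N$ and $G=(V,E)\in\mathcal{G}_N$, $\chi_{r,s}(G)=1-2\cdot\mathbf{1}_G(r,s)$, where $\mathbf{1}_G(r,s)=1$ if $(r,s)\in E$ and $0$ otherwise. Unions and intersections of graphs on $V$ are taken edge-wise: $(V,E_1)\cup(V,E_2)=(V,E_1\cup E_2)$ and $(V,E_1)\cap(V,E_2)=(V,E_1\cap E_2)$. $K_N$ is the complete graph on $V$ and $\overline{K_N}$ is the graph on $V$ with no edges. For $\phi:\mathcal{G}_N\to\mathbb{R}$ let $Z(\phi)=\sum_{G\in\mathcal{G}_N}e^{\phi(G)}$ (weight $\mu\equiv1$) and $e(\phi)=e^{\phi}/Z(\phi)$; $e(\mathcal{B}^{\mathcal{G}_N})=\{e(\phi):\phi\in\mathcal{B}^{\mathcal{G}_N}\}$. An element $\hat p\in e(\mathcal{B}^{\mathcal{G}_N})$ is the MLE for $e(\mathcal{B}^{\mathcal{G}_N})$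 and $G_1,\ldots,G_n$ if $\prod_{i=1}^n\hat p(G_i)=\sup_{p\in e(\mathcal{B}^{\mathcal{G}_N})}\prod_{i=1}^np(G_i)$. *)

theory Defs
  imports Complex_Main "HOL-Library.Function_Algebras"
begin

type_synonym graph = "nat set \<times> nat set set"

abbreviation verts :: "graph \<Rightarrow> nat set" where
  "verts \<equiv> fst"

abbreviation edges :: "graph \<Rightarrow> nat set set" where
  "edges \<equiv> snd"

definition graphs :: "nat \<Rightarrow> graph set" where
  "graphs N = {G. verts G = {1..N} \<and> edges G \<subseteq> {e. e \<subseteq> {1..N} \<and> card e = 2}}"

definition complete_graph :: "nat \<Rightarrow> graph" where
  "complete_graph N = ({1..N}, {e. e \<subseteq> {1..N} \<and> card e = 2})"

definition empty_graph :: "nat \<Rightarrow> graph" where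
  "empty_graph N = ({1..N}, {})"

definition graph_UN :: "nat \<Rightarrow> 'i set \<Rightarrow> ('i \<Rightarrow> graph) \<Rightarrow> graph" where
  "graph_UN N I G = ({1..N}, \<Union>i\<in>I. edges (G i))"

text \<open>Only meant for nonempty \<open>I\<close>, as the intersection of an empty family of edge sets is
  \<open>UNIV\<close>.\<close>

definition graph_INT :: "nat \<Rightarrow> 'i set \<Rightarrow> ('i \<Rightarrow> graph) \<Rightarrow> graph" where
  "graph_INT N I G = ({1..N}, \<Inter>i\<in>I. edges (G i))"

text \<open>A real function on a set \<open>\<Omega>\<close> is represented by its extension by \<open>0\<close> to the whole type, so
  that the functions on \<open>\<Omega>\<close> form a linear subspace of the function type with its pointwise
  operations, and equality of representatives is equality on \<open>\<Omega>\<close>.\<close>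

definition on_set :: "'a set \<Rightarrow> ('a \<Rightarrow> real) \<Rightarrow> 'a \<Rightarrow> real" where
  "on_set \<Omega> f = (\<lambda>x. if x \<in> \<Omega> then f x else 0)"

definition fscale :: "real \<Rightarrow> ('a \<Rightarrow> real) \<Rightarrow> 'a \<Rightarrow> real" where
  "fscale c f = (\<lambda>x. c * f x)"

interpretation real_fun: vector_space fscale
  by unfold_locales (auto simp: fscale_def fun_eq_iff algebra_simps)

definition chi :: "nat \<Rightarrow> nat \<Rightarrow> nat \<Rightarrow> graph \<Rightarrow> real" where
  "chi N r s = on_set (graphs N) (\<lambda>G. 1 - 2 * (if {r, s} \<in> edges G then 1 else 0))"

definition B_graphs :: "nat \<Rightarrow> (graph \<Rightarrow> real) set" where
  "B_graphs N = real_fun.span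
     (insert (on_set (graphs N) (\<lambda>G. 1)) {chi N r s | r s. 1 \<le> r \<and> r < s \<and> s \<le> N})"

definition Z :: "'a set \<Rightarrow> ('a \<Rightarrow> real) \<Rightarrow> real" where
  "Z \<Omega> \<phi> = (\<Sum>x\<in>\<Omega>. exp (\<phi> x))"

definition expo :: "'a set \<Rightarrow> ('a \<Rightarrow> real) \<Rightarrow> 'a \<Rightarrow> real" where
  "expo \<Omega> \<phi> = on_set \<Omega> (\<lambda>x. exp (\<phi> x) / Z \<Omega> \<phi>)"

text \<open>The supremum is the one of the reals. It is a genuine least upper bound when \<open>P\<close> is a
  nonempty set of probability mass functions, since the likelihoods then lie in \<open>[0, 1]\<close>.\<close>

definition is_MLE :: "('a \<Rightarrow> real) set \<Rightarrow> nat \<Rightarrow> (nat \<Rightarrow> 'a) \<Rightarrow> ('a \<Rightarrow> real) \<Rightarrow> bool" where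
  "is_MLE P n x p \<longleftrightarrow>
     p \<in> P \<and> (\<Prod>i=1..n. p (x i)) = (SUP q\<in>P. \<Prod>i=1..n. q (x i))"

end

theory Submission
  imports Defs
begin

text \<open>
  The idea. The log-likelihood of \<open>expo \<Omega> \<phi>\<close> is \<open>(\<Sum>i. \<phi> (x i)) - n * ln (Z \<Omega> \<phi>)\<close>,
  a concave function of
  \<open>\<phi>\<close>. Two general facts about such exponential families decide whether it attains its maximum.

  If the model space contains a direction \<open>f\<close> that is nonconstant on \<open>\<Omega>\<close> but takes its maximum at
  every observation, then moving along \<open>f\<close> shifts mass towards all the observations at once, so
  every likelihood can be improved (\<open>no_MLE_if_direction_maximal_at_data\<close>). An edge that is in none
  of the \<open>G\<^sub>i\<close> gives such a direction, namely its sign \<open>\<chi>\<close>, and an edge that is in all of them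
  gives \<open>-\<chi>\<close>. Hence the two conditions on the union and the intersection are necessary.

  Conversely, a member of the family under which each function of the model space has the same mean
  as in the data is an MLE; this is Gibbs' inequality (\<open>is_MLE_if_moments_match\<close>). For graphs such a
  member can be written down. In \<open>\<phi> = \<Sum>e. a e * \<chi>\<^sub>e\<close> the edges are independent, because the sum
  over all edge sets of a product over edges factorises, and the mean of \<open>\<chi>\<^sub>d\<close> is \<open>tanh (a d)\<close>
  (\<open>expectation_edge_sign\<close>). The empirical mean of \<open>\<chi>\<^sub>d\<close> lies strictly between \<open>-1\<close> and \<open>1\<close> exactly
  when the edge \<open>d\<close> is present in some observation and absent from another, and then it is matched by
  \<open>a d = artanh\<close> of it.
\<close>

section \<open>Likelihood in finite exponential families\<close>

lemma Z_pos:
  assumes "finite \<Omega>" and "\<Omega> \<noteq> {}"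
  shows "Z \<Omega> \<phi> > 0"
  unfolding Z_def using assms by (intro sum_pos) auto

lemma expo_eq: "x \<in> \<Omega> \<Longrightarrow> expo \<Omega> \<phi> x = exp (\<phi> x) / Z \<Omega> \<phi>"
  by (simp add: expo_def on_set_def)

lemma expo_pos:
  assumes "finite \<Omega>" and "x \<in> \<Omega>"
  shows "expo \<Omega> \<phi> x > 0"
proof -
  have "Z \<Omega> \<phi> > 0" using assms by (intro Z_pos) auto
  then show ?thesis using assms by (simp add: expo_eq)
qed

lemma sum_expo:
  assumes "finite \<Omega>" and "\<Omega> \<noteq> {}"
  shows "(\<Sum>x\<in>\<Omega>. expo \<Omega> \<phi> x) = 1"
proof -
  have "(\<Sum>x\<in>\<Omega>. expo \<Omega> \<phi> x) = Z \<Omega> \<phi> / Z \<Omega> \<phi>"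
    by (simp add: expo_eq Z_def flip: sum_divide_distrib)
  then show ?thesis using Z_pos[OF assms, of \<phi>] by simp
qed

lemma expo_le_1:
  assumes "finite \<Omega>" and "x \<in> \<Omega>"
  shows "expo \<Omega> \<phi> x \<le> 1"
proof -
  have "expo \<Omega> \<phi> x \<le> (\<Sum>y\<in>\<Omega>. expo \<Omega> \<phi> y)"
    using assms by (intro member_le_sum) (auto intro: less_imp_le expo_pos)
  also have "\<dots> = 1" using assms by (intro sum_expo) auto
  finally show ?thesis .
qed

text \<open>Likelihoods are bounded by \<open>1\<close>, so the real supremum in the definition of an MLE is a genuine
  one and an MLE is the same as a maximiser.\<close>

lemma is_MLE_expo_iff:
  assumes "finite \<Omega>" and "\<And>i. i \<in> {1..n} \<Longrightarrow> x i \<in> \<Omega>"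
  shows "is_MLE (expo \<Omega> ` B) n x p \<longleftrightarrow>
    p \<in> expo \<Omega> ` B \<and> (\<forall>\<phi>\<in>B. (\<Prod>i=1..n. expo \<Omega> \<phi> (x i)) \<le> (\<Prod>i=1..n. p (x i)))"
proof -
  let ?L = "\<lambda>q. \<Prod>i=1..n. q (x i)"
  have "?L q \<le> 1" if "q \<in> expo \<Omega> ` B" for q
    using that assms by (intro prod_le_1) (auto intro: less_imp_le expo_pos expo_le_1)
  then have bdd: "bdd_above (?L ` expo \<Omega> ` B)"
    by (intro bdd_aboveI[of _ 1]) auto
  show ?thesis
  proof
    assume *: "is_MLE (expo \<Omega> ` B) n x p"
    have "?L (expo \<Omega> \<phi>) \<le> (SUP q\<in>expo \<Omega> ` B. ?L q)" if "\<phi> \<in> B" for \<phi>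
      by (rule cSUP_upper[OF imageI[OF that] bdd])
    with * show "p \<in> expo \<Omega> ` B \<and> (\<forall>\<phi>\<in>B. ?L (expo \<Omega> \<phi>) \<le> ?L p)"
      by (simp add: is_MLE_def)
  next
    assume *: "p \<in> expo \<Omega> ` B \<and> (\<forall>\<phi>\<in>B. ?L (expo \<Omega> \<phi>) \<le> ?L p)"
    then have "(SUP q\<in>expo \<Omega> ` B. ?L q) = ?L p"
      by (intro cSup_eq_maximum imageI) auto
    with * show "is_MLE (expo \<Omega> ` B) n x p"
      by (simp add: is_MLE_def)
  qed
qed

text \<open>Adding \<open>f\<close> to \<open>\<phi>\<close> multiplies the unnormalised weight of each observation by \<open>exp M\<close>, but
  the partition function by strictly less, since \<open>f < M\<close> somewhere. So the probability of every
  observation grows.\<close>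

lemma no_MLE_if_direction_maximal_at_data:
  assumes "finite \<Omega>" and "n \<ge> 1" and data: "\<And>i. i \<in> {1..n} \<Longrightarrow> x i \<in> \<Omega>"
    and step: "\<And>\<phi>. \<phi> \<in> B \<Longrightarrow> \<phi> + f \<in> B"
    and le: "\<And>y. y \<in> \<Omega> \<Longrightarrow> f y \<le> M"
    and maximal: "\<And>i. i \<in> {1..n} \<Longrightarrow> f (x i) = M"
    and y: "y \<in> \<Omega>" "f y < M"
  shows "\<not> is_MLE (expo \<Omega> ` B) n x p"
proof
  assume "is_MLE (expo \<Omega> ` B) n x p"
  then have "p \<in> expo \<Omega> ` B \<and>
      (\<forall>\<psi>\<in>B. (\<Prod>i=1..n. expo \<Omega> \<psi> (x i)) \<le> (\<Prod>i=1..n. p (x i)))"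
    by (intro is_MLE_expo_iff[THEN iffD1] assms(1) data)
  then obtain \<phi> where \<phi>: "\<phi> \<in> B"
    and max: "\<And>\<psi>. \<psi> \<in> B \<Longrightarrow> (\<Prod>i=1..n. expo \<Omega> \<psi> (x i)) \<le> (\<Prod>i=1..n. expo \<Omega> \<phi> (x i))"
    by auto
  have Z_less: "Z \<Omega> (\<phi> + f) < exp M * Z \<Omega> \<phi>"
    unfolding Z_def sum_distrib_left
  proof (rule sum_strict_mono_ex1)
    show "\<forall>z\<in>\<Omega>. exp ((\<phi> + f) z) \<le> exp M * exp (\<phi> z)"
      using le by (auto simp flip: exp_add)
    show "\<exists>z\<in>\<Omega>. exp ((\<phi> + f) z) < exp M * exp (\<phi> z)"
      using y by (auto simp flip: exp_add)
  qed fact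
  have less: "expo \<Omega> \<phi> (x i) < expo \<Omega> (\<phi> + f) (x i)" if i: "i \<in> {1..n}" for i
  proof -
    have Zs: "Z \<Omega> \<phi> > 0" "Z \<Omega> (\<phi> + f) > 0"
      using Z_pos[of \<Omega>] assms(1) y by auto
    have "exp (\<phi> (x i)) * Z \<Omega> (\<phi> + f) < exp (\<phi> (x i)) * (exp M * Z \<Omega> \<phi>)"
      using Z_less by simp
    then have "exp (\<phi> (x i)) / Z \<Omega> \<phi> < exp (\<phi> (x i)) * exp M / Z \<Omega> (\<phi> + f)"
      using Zs by (simp add: field_simps)
    then show ?thesis
      using i data maximal by (simp add: expo_eq exp_add)
  qed
  have "(\<Prod>i=1..n. expo \<Omega> \<phi> (x i)) < (\<Prod>i=1..n. expo \<Omega> (\<phi> + f) (x i))"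
  proof (rule prod_mono_strict[of 1])
    show "1 \<in> {1..n}" using \<open>n \<ge> 1\<close> by simp
    then show "expo \<Omega> \<phi> (x 1) < expo \<Omega> (\<phi> + f) (x 1)" by (rule less)
  qed (use less data assms(1) in \<open>auto intro: less_imp_le expo_pos\<close>)
  with max[OF step[OF \<phi>]] show False by simp
qed

text \<open>This is the nonnegativity of the relative entropy of \<open>expo \<Omega> \<phi>\<close> with respect to
  \<open>expo \<Omega> \<psi>\<close>, written in terms of the exponents. It comes from \<open>1 + u \<le> exp u\<close>, applied to the
  log-ratio of the two densities.\<close>

lemma Gibbs_inequality:
  assumes "finite \<Omega>" and "\<Omega> \<noteq> {}"
  shows "(\<Sum>x\<in>\<Omega>. expo \<Omega> \<phi> x * \<psi> x) - ln (Z \<Omega> \<psi>) \<le> (\<Sum>x\<in>\<Omega>. expo \<Omega> \<phi> x * \<phi> x) - ln (Z \<Omega> \<phi>)"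
proof -
  let ?p = "expo \<Omega> \<phi>" and ?t = "ln (Z \<Omega> \<psi>) - ln (Z \<Omega> \<phi>)"
  note Zs = Z_pos[OF assms, of \<phi>] Z_pos[OF assms, of \<psi>]
  have "?p x * (1 + (\<psi> x - \<phi> x - ?t)) \<le> expo \<Omega> \<psi> x" if "x \<in> \<Omega>" for x
  proof -
    have "?p x * (1 + (\<psi> x - \<phi> x - ?t)) \<le> ?p x * exp (\<psi> x - \<phi> x - ?t)"
      using that expo_pos[OF assms(1) that, of \<phi>] by (intro mult_left_mono exp_ge_add_one_self) auto
    also have "\<dots> = expo \<Omega> \<psi> x"
      using that Zs by (simp add: expo_eq exp_diff)
    finally show ?thesis .
  qed
  then have "(\<Sum>x\<in>\<Omega>. ?p x * (1 + (\<psi> x - \<phi> x - ?t))) \<le> (\<Sum>x\<in>\<Omega>. expo \<Omega> \<psi> x)"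
    by (rule sum_mono)
  also have "\<dots> = 1" by (rule sum_expo[OF assms])
  also have "(\<Sum>x\<in>\<Omega>. ?p x * (1 + (\<psi> x - \<phi> x - ?t))) =
      (\<Sum>x\<in>\<Omega>. (1 - ?t) * ?p x + ?p x * \<psi> x - ?p x * \<phi> x)"
    by (intro sum.cong) (auto simp: algebra_simps)
  also have "\<dots> = (1 - ?t) + (\<Sum>x\<in>\<Omega>. ?p x * \<psi> x) - (\<Sum>x\<in>\<Omega>. ?p x * \<phi> x)"
    by (simp add: sum.distrib sum_subtractf sum_expo[OF assms] flip: sum_distrib_left)
  finally show ?thesis by simp
qed

lemma likelihood_eq:
  fixes n :: nat
  assumes "finite \<Omega>" and "\<Omega> \<noteq> {}" and "\<And>i. i \<in> {1..n} \<Longrightarrow> x i \<in> \<Omega>"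
  shows "(\<Prod>i=1..n. expo \<Omega> \<phi> (x i)) = exp ((\<Sum>i=1..n. \<phi> (x i)) - n * ln (Z \<Omega> \<phi>))"
proof -
  have "(\<Prod>i=1..n. expo \<Omega> \<phi> (x i)) = (\<Prod>i=1..n. exp (\<phi> (x i) - ln (Z \<Omega> \<phi>)))"
    using assms Z_pos[OF assms(1,2), of \<phi>] by (intro prod.cong) (auto simp: expo_eq exp_diff)
  also have "\<dots> = exp (\<Sum>i=1..n. \<phi> (x i) - ln (Z \<Omega> \<phi>))"
    by (simp add: exp_sum)
  finally show ?thesis by (simp add: sum_subtractf)
qed

text \<open>If the moments match, then for each \<open>\<psi>\<close> in the model space the log-likelihood of \<open>expo \<Omega> \<psi>\<close>
  is \<open>n\<close> times the expectation of \<open>ln (expo \<Omega> \<psi>)\<close> under \<open>expo \<Omega> \<phi>\<close>, which Gibbs' inequality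
  bounds by its value at \<open>\<psi> = \<phi>\<close>.\<close>

lemma is_MLE_if_moments_match:
  fixes n :: nat
  assumes "finite \<Omega>" and "\<Omega> \<noteq> {}" and data: "\<And>i. i \<in> {1..n} \<Longrightarrow> x i \<in> \<Omega>"
    and \<phi>: "\<phi> \<in> B"
    and moments: "\<And>\<psi>. \<psi> \<in> B \<Longrightarrow> n * (\<Sum>y\<in>\<Omega>. expo \<Omega> \<phi> y * \<psi> y) = (\<Sum>i=1..n. \<psi> (x i))"
  shows "is_MLE (expo \<Omega> ` B) n x (expo \<Omega> \<phi>)"
proof -
  have "(\<Prod>i=1..n. expo \<Omega> \<psi> (x i)) \<le> (\<Prod>i=1..n. expo \<Omega> \<phi> (x i))" if "\<psi> \<in> B" for \<psi>
  proof -
    have "(\<Sum>i=1..n. \<psi> (x i)) - n * ln (Z \<Omega> \<psi>) \<le> (\<Sum>i=1..n. \<phi> (x i)) - n * ln (Z \<Omega> \<phi>)"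
      using mult_left_mono[OF Gibbs_inequality[OF assms(1,2), of \<phi> \<psi>], of n]
      by (simp add: right_diff_distrib moments[OF that] moments[OF \<phi>])
    then show ?thesis
      by (simp only: likelihood_eq[where n = n and x = x, OF assms(1,2) data] exp_le_cancel_iff)
  qed
  then show ?thesis
    using \<phi> is_MLE_expo_iff[where n = n and x = x, OF assms(1) data] by blast
qed

section \<open>Edge signs on the space of graphs\<close>

definition all_edges :: "nat \<Rightarrow> nat set set" where
  "all_edges N = {e. e \<subseteq> {1..N} \<and> card e = 2}"

text \<open>The function \<open>\<chi>\<close> of an edge, indexed by the edge itself instead of its sorted endpoints, so
  that products over edges are products over a set.\<close>

definition edge_sign :: "nat \<Rightarrow> nat set \<Rightarrow> graph \<Rightarrow> real" where
  "edge_sign N e = on_set (graphs N) (\<lambda>G. if e \<in> edges G then -1 else 1)"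

lemma finite_all_edges [simp]: "finite (all_edges N)"
  by (rule finite_subset[of _ "Pow {1..N}"]) (auto simp: all_edges_def)

lemma graphs_eq: "graphs N = Pair {1..N} ` Pow (all_edges N)"
  by (auto simp: graphs_def all_edges_def image_iff)

lemma finite_graphs [simp]: "finite (graphs N)"
  by (simp add: graphs_eq)

lemma graphs_nonempty [simp]: "graphs N \<noteq> {}"
  by (auto simp: graphs_eq)

lemma edge_sign_eq: "G \<in> graphs N \<Longrightarrow> edge_sign N e G = (if e \<in> edges G then -1 else 1)"
  by (simp add: edge_sign_def on_set_def)

lemma chi_set_eq_edge_signs:
  "{chi N r s | r s. 1 \<le> r \<and> r < s \<and> s \<le> N} = edge_sign N ` all_edges N"
proof -
  have chi: "chi N r s = edge_sign N {r, s}" for r s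
    by (auto simp: chi_def edge_sign_def on_set_def fun_eq_iff)
  have "\<exists>r s. e = {r, s} \<and> 1 \<le> r \<and> r < s \<and> s \<le> N" if "e \<in> all_edges N" for e
  proof -
    obtain a b where "e = {a, b}" "a \<noteq> b"
      using \<open>e \<in> all_edges N\<close> by (auto simp: all_edges_def card_2_iff)
    with that have "e = {min a b, max a b} \<and> 1 \<le> min a b \<and> min a b < max a b \<and> max a b \<le> N"
      by (auto simp: all_edges_def min_def max_def)
    then show ?thesis by blast
  qed
  moreover have "{r, s} \<in> all_edges N" if "1 \<le> r" "r < s" "s \<le> N" for r s
    using that by (simp add: all_edges_def)
  ultimately show ?thesis
    unfolding chi by blast
qed

lemma B_graphs_eq:
  "B_graphs N = real_fun.span (insert (on_set (graphs N) (\<lambda>_. 1)) (edge_sign N ` all_edges N))"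
  unfolding B_graphs_def chi_set_eq_edge_signs ..

lemma edge_sign_in_B: "e \<in> all_edges N \<Longrightarrow> edge_sign N e \<in> B_graphs N"
  unfolding B_graphs_eq by (intro real_fun.span_base) auto

lemma edge_combination_in_B:
  "(\<lambda>G. \<Sum>e\<in>all_edges N. a e * edge_sign N e G) \<in> B_graphs N"
proof -
  have "(\<lambda>G. \<Sum>e\<in>A. a e * edge_sign N e G) = (\<Sum>e\<in>A. fscale (a e) (edge_sign N e))" for A
    by (induction A rule: infinite_finite_induct) (auto simp: fun_eq_iff fscale_def)
  then show ?thesis
    using edge_sign_in_B unfolding B_graphs_eq
    by (auto intro!: real_fun.span_sum real_fun.span_scale)
qed

section \<open>Independence of the edges\<close>

lemma sum_graphs_prod_edges:
  fixes h :: "nat set \<Rightarrow> real \<Rightarrow> real"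
  shows "(\<Sum>G\<in>graphs N. \<Prod>e\<in>all_edges N. h e (edge_sign N e G)) =
    (\<Prod>e\<in>all_edges N. h e (-1) + h e 1)"
proof -
  let ?E = "all_edges N"
  have "(\<Sum>G\<in>graphs N. \<Prod>e\<in>?E. h e (edge_sign N e G)) =
      (\<Sum>X\<in>Pow ?E. \<Prod>e\<in>?E. h e (edge_sign N e ({1..N}, X)))"
    unfolding graphs_eq by (subst sum.reindex) (auto simp: inj_on_def)
  also have "\<dots> = (\<Sum>X\<in>Pow ?E. (\<Prod>e\<in>X. h e (-1)) * (\<Prod>e\<in>?E - X. h e 1))"
  proof (rule sum.cong)
    fix X assume X: "X \<in> Pow ?E"
    then have "({1..N}, X) \<in> graphs N" by (simp add: graphs_eq)
    then have "(\<Prod>e\<in>?E. h e (edge_sign N e ({1..N}, X))) =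
        (\<Prod>e\<in>?E. if e \<in> X then h e (-1) else h e 1)"
      by (intro prod.cong) (auto simp: edge_sign_eq)
    also have "\<dots> = (\<Prod>e\<in>X. h e (-1)) * (\<Prod>e\<in>?E - X. h e 1)"
      using X by (simp add: prod.If_cases Int_absorb1 Diff_eq)
    finally show "(\<Prod>e\<in>?E. h e (edge_sign N e ({1..N}, X))) =
        (\<Prod>e\<in>X. h e (-1)) * (\<Prod>e\<in>?E - X. h e 1)" .
  qed simp
  also have "\<dots> = (\<Prod>e\<in>?E. h e (-1) + h e 1)"
    by (simp add: prod_add)
  finally show ?thesis .
qed

text \<open>Both the partition function and its analogue weighted by the sign of \<open>d\<close> factorise over the
  edges. The two products agree except in the factor of \<open>d\<close>, where \<open>exp (a d) + exp (- a d)\<close> is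
  replaced by \<open>exp (a d) - exp (- a d)\<close>.\<close>

lemma expectation_edge_sign:
  fixes N :: nat and a :: "nat set \<Rightarrow> real"
  defines "\<phi> \<equiv> \<lambda>G. \<Sum>e\<in>all_edges N. a e * edge_sign N e G"
  assumes d: "d \<in> all_edges N"
  shows "(\<Sum>G\<in>graphs N. expo (graphs N) \<phi> G * edge_sign N d G) = tanh (a d)"
proof -
  let ?E = "all_edges N" and ?c = "\<lambda>e. exp (- a e) + exp (a e)"
  have Z: "Z (graphs N) \<phi> = prod ?c ?E"
    using sum_graphs_prod_edges[where h = "\<lambda>e s. exp (a e * s)"]
    by (simp add: Z_def \<phi>_def exp_sum)
  have "(\<Sum>G\<in>graphs N. exp (\<phi> G) * edge_sign N d G) =
      (\<Sum>G\<in>graphs N. \<Prod>e\<in>?E. (if e = d then edge_sign N e G else 1) * exp (a e * edge_sign N e G))"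
    using d by (simp add: \<phi>_def exp_sum prod.distrib prod.delta mult.commute)
  also have "\<dots> = (\<Prod>e\<in>?E. (if e = d then -1 else 1) * exp (- a e) + exp (a e))"
    using sum_graphs_prod_edges[where h = "\<lambda>e s. (if e = d then s else 1) * exp (a e * s)"]
    by (simp cong: if_cong)
  also have "\<dots> = (\<Prod>e\<in>?E. (if e = d then tanh (a e) else 1) * ?c e)"
  proof (rule prod.cong)
    fix e
    have "exp (- a e) + exp (a e) > 0" by (simp add: add_pos_pos)
    then show "(if e = d then -1 else 1) * exp (- a e) + exp (a e) =
        (if e = d then tanh (a e) else 1) * ?c e"
      by (cases "e = d") (simp_all add: tanh_altdef add.commute)
  qed simp
  also have "\<dots> = tanh (a d) * Z (graphs N) \<phi>"
    using d by (simp add: Z prod.distrib prod.delta)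
  finally have "(\<Sum>G\<in>graphs N. exp (\<phi> G) * edge_sign N d G) / Z (graphs N) \<phi> = tanh (a d)"
    using Z_pos[of "graphs N" \<phi>] by simp
  then show ?thesis
    by (simp add: expo_eq sum_divide_distrib)
qed

lemma tanh_artanh_real:
  fixes m :: real
  assumes "-1 < m" and "m < 1"
  shows "tanh (artanh m) = m"
proof -
  have "exp (- 2 * artanh m) = (1 - m) / (1 + m)"
    using assms by (simp add: artanh_def exp_minus)
  moreover have "1 - (1 - m) / (1 + m) = 2 * m / (1 + m)" "1 + (1 - m) / (1 + m) = 2 / (1 + m)"
    using assms by (simp_all add: field_simps)
  ultimately show ?thesis
    using assms by (simp add: tanh_real_altdef)
qed

section \<open>Existence of the maximum likelihood estimator\<close>

text \<open>This keeps the empirical mean of an edge sign away from \<open>-1\<close> and \<open>1\<close>, where \<open>artanh\<close> would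
  have to be infinite.\<close>

lemma abs_sum_signs_less:
  fixes f :: "'i \<Rightarrow> real"
  assumes "finite I" and "\<And>i. i \<in> I \<Longrightarrow> \<bar>f i\<bar> \<le> 1"
    and "j \<in> I" "f j < 1" and "k \<in> I" "f k > -1"
  shows "\<bar>sum f I\<bar> < card I"
proof -
  have "sum f I < (\<Sum>i\<in>I. 1)"
    using assms by (intro sum_strict_mono_ex1) (force simp: abs_le_iff)+
  moreover have "(\<Sum>i\<in>I. -1) < sum f I"
    using assms by (intro sum_strict_mono_ex1) (force simp: abs_le_iff)+
  ultimately show ?thesis by (simp add: abs_less_iff)
qed

text \<open>The coefficient \<open>artanh (m e)\<close> makes the mean of each edge sign equal to its empirical mean
  \<open>m e\<close>. Both kinds of mean are linear, so they then agree on the whole span.\<close>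

lemma MLE_exists_if_every_edge_varies:
  fixes n :: nat
  assumes data: "\<And>i. i \<in> {1..n} \<Longrightarrow> G i \<in> graphs N"
    and varies: "\<And>e. e \<in> all_edges N \<Longrightarrow>
      (\<exists>i\<in>{1..n}. e \<in> edges (G i)) \<and> (\<exists>i\<in>{1..n}. e \<notin> edges (G i))"
  shows "\<exists>p. is_MLE (expo (graphs N) ` B_graphs N) n G p"
proof -
  define m where "m e = (\<Sum>i=1..n. edge_sign N e (G i)) / n" for e
  define \<phi> where "\<phi> = (\<lambda>H. \<Sum>e\<in>all_edges N. artanh (m e) * edge_sign N e H)"
  let ?mean = "\<lambda>\<psi>. \<Sum>H\<in>graphs N. expo (graphs N) \<phi> H * \<psi> H"
  have \<phi>: "\<phi> \<in> B_graphs N"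
    unfolding \<phi>_def by (rule edge_combination_in_B)
  have mean_edge: "n * ?mean (edge_sign N e) = (\<Sum>i=1..n. edge_sign N e (G i))"
    if e: "e \<in> all_edges N" for e
  proof -
    obtain j k where jk: "j \<in> {1..n}" "e \<in> edges (G j)" "k \<in> {1..n}" "e \<notin> edges (G k)"
      using varies[OF e] by blast
    then have n: "n > 0" by auto
    have "\<bar>\<Sum>i=1..n. edge_sign N e (G i)\<bar> < card {1..n}"
      by (rule abs_sum_signs_less[of _ _ j k]) (use jk data in \<open>auto simp: edge_sign_eq\<close>)
    then have "-1 < m e" "m e < 1"
      using n by (auto simp: m_def field_simps abs_less_iff)
    then have "?mean (edge_sign N e) = m e"
      unfolding \<phi>_def by (simp add: expectation_edge_sign[OF e] tanh_artanh_real)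
    then show ?thesis using n by (simp add: m_def)
  qed
  have "n * ?mean \<psi> = (\<Sum>i=1..n. \<psi> (G i))" if "\<psi> \<in> B_graphs N" for \<psi>
    using that unfolding B_graphs_eq
  proof (induction rule: real_fun.span_induct_alt)
    case base
    then show ?case by simp
  next
    case (step c f \<psi>)
    have "n * ?mean f = (\<Sum>i=1..n. f (G i))"
      using step.hyps
    proof
      assume f: "f = on_set (graphs N) (\<lambda>_. 1)"
      have "?mean f = 1"
        by (simp add: f on_set_def sum_expo)
      then show ?thesis using data by (simp add: f on_set_def)
    qed (auto simp: mean_edge)
    moreover have "n * ?mean (fscale c f + \<psi>) = c * (n * ?mean f) + n * ?mean \<psi>"
      by (simp add: fscale_def algebra_simps sum.distrib sum_distrib_left)
    ultimately show ?case
      using step.IH by (simp add: fscale_def sum.distrib sum_distrib_left)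
  qed
  then have "is_MLE (expo (graphs N) ` B_graphs N) n G (expo (graphs N) \<phi>)"
    using data \<phi> by (intro is_MLE_if_moments_match) auto
  then show ?thesis by blast
qed

text \<open>The improving direction is the sign of \<open>e\<close>, up to the factor \<open>c\<close> that makes it equal to \<open>1\<close> on
  the data.\<close>

lemma no_MLE_if_edge_constant:
  fixes b :: bool
  assumes "n \<ge> 1" and data: "\<And>i. i \<in> {1..n} \<Longrightarrow> G i \<in> graphs N"
    and e: "e \<in> all_edges N" and const: "\<And>i. i \<in> {1..n} \<Longrightarrow> e \<in> edges (G i) \<longleftrightarrow> b"
  shows "\<not> is_MLE (expo (graphs N) ` B_graphs N) n G p"
proof -
  define c :: real where "c = (if b then -1 else 1)"
  \<comment> \<open>any graph that disagrees with the data on \<open>e\<close>\<close>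
  define H :: graph where "H = ({1..N}, if b then {} else {e})"
  have H: "H \<in> graphs N" "e \<in> edges H \<longleftrightarrow> \<not> b"
    using e by (auto simp: H_def graphs_eq)
  show ?thesis
  proof (rule no_MLE_if_direction_maximal_at_data)
    fix \<phi> assume "\<phi> \<in> B_graphs N"
    then show "\<phi> + fscale c (edge_sign N e) \<in> B_graphs N"
      using edge_sign_in_B[OF e] unfolding B_graphs_eq
      by (intro real_fun.span_add real_fun.span_scale)
  next
    show "fscale c (edge_sign N e) y \<le> 1" if "y \<in> graphs N" for y
      using that by (simp add: fscale_def edge_sign_eq c_def)
    show "fscale c (edge_sign N e) (G i) = 1" if "i \<in> {1..n}" for i
      using that data const by (simp add: fscale_def edge_sign_eq c_def)
    show "fscale c (edge_sign N e) H < 1"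
      using H by (simp add: fscale_def edge_sign_eq c_def)
  qed (use assms H in auto)
qed

theorem theorem4p3:
  fixes N n :: nat and G :: "nat \<Rightarrow> graph"
  assumes "N \<ge> 1" and "n \<ge> 1" and "\<And>i. i \<in> {1..n} \<Longrightarrow> G i \<in> graphs N"
  shows "(\<exists>p. is_MLE (expo (graphs N) ` B_graphs N) n G p) \<longleftrightarrow>
    graph_UN N {1..n} G = complete_graph N \<and> graph_INT N {1..n} G = empty_graph N"
proof -
  have sub: "edges (G i) \<subseteq> all_edges N" if "i \<in> {1..n}" for i
    using assms(3)[OF that] by (simp add: graphs_def all_edges_def)
  have complete: "complete_graph N = ({1..N}, all_edges N)"
    by (simp add: complete_graph_def all_edges_def)
  have "(\<Union>i\<in>{1..n}. edges (G i)) = all_edges N \<longleftrightarrow>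
      (\<forall>e\<in>all_edges N. \<exists>i\<in>{1..n}. e \<in> edges (G i))"
    using sub by blast
  then have UN: "graph_UN N {1..n} G = complete_graph N \<longleftrightarrow>
      (\<forall>e\<in>all_edges N. \<exists>i\<in>{1..n}. e \<in> edges (G i))"
    unfolding graph_UN_def complete by simp
  have "(\<Inter>i\<in>{1..n}. edges (G i)) \<subseteq> edges (G 1)"
    using \<open>n \<ge> 1\<close> by (intro INT_lower) simp
  also have "\<dots> \<subseteq> all_edges N"
    using \<open>n \<ge> 1\<close> by (intro sub) simp
  finally have "(\<Inter>i\<in>{1..n}. edges (G i)) = {} \<longleftrightarrow>
      (\<forall>e\<in>all_edges N. \<exists>i\<in>{1..n}. e \<notin> edges (G i))"
    by blast
  then have INT: "graph_INT N {1..n} G = empty_graph N \<longleftrightarrow>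
      (\<forall>e\<in>all_edges N. \<exists>i\<in>{1..n}. e \<notin> edges (G i))"
    unfolding graph_INT_def empty_graph_def by simp
  show ?thesis
    unfolding UN INT
  proof
    assume "\<exists>p. is_MLE (expo (graphs N) ` B_graphs N) n G p"
    then show "(\<forall>e\<in>all_edges N. \<exists>i\<in>{1..n}. e \<in> edges (G i)) \<and>
        (\<forall>e\<in>all_edges N. \<exists>i\<in>{1..n}. e \<notin> edges (G i))"
      using no_MLE_if_edge_constant[where G = G and n = n, OF assms(2,3), where b = True]
        no_MLE_if_edge_constant[where G = G and n = n, OF assms(2,3), where b = False] by blast
  next
    assume "(\<forall>e\<in>all_edges N. \<exists>i\<in>{1..n}. e \<in> edges (G i)) \<and>
        (\<forall>e\<in>all_edges N. \<exists>i\<in>{1..n}. e \<notin> edges (G i))"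
    then show "\<exists>p. is_MLE (expo (graphs N) ` B_graphs N) n G p"
      using MLE_exists_if_every_edge_varies[where n = n and G = G, OF assms(3)] by blast
  qed
qed

end
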